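(* Let $\{\theta_n\}_{n\ge 0}$ be the sequence generated by the stochastic algorithm $\theta_{n+1}=\theta_n+\alpha F_n$ with deterministic $\theta_0\in\Theta$, and let $\varphi:\mathbb{R}_{\ge 0}\times\Theta\to\Theta$ be the flow of the mean ODE, i.e. for each $\theta\in\Theta$, $\varphi(\cdot;\theta)$ is absolutely continuous and $\varphi(t;\theta)=\theta+\int_0^t F(\varphi(\tau;\theta))\,\mathrm{d}\tau$ for all $t\ge 0$. Suppose that $\Psi:\Theta\to\mathbb{R}_{\ge 0}$ satisfies the following two conditions. (A1) There exists a nonincreasing $\Delta_{1}:\mathbb{R}_{\ge 0}\to\mathbb{R}_{\ge 0}$ with $\Delta_1(t)\downarrow 0$ as $t\uparrow\infty$ and $\Psi(\varphi(t;\theta))\le \Delta_1(t)\Psi(\theta)$ for any $\theta\in\Theta$, $t\ge 0$. (A2) There exists $\Delta_2:\mathbb{R}_+\times\mathbb{R}_+\to\mathbb{R}_+$, nondecreasing with respect to each argument, with $\Delta_2(\alpha,T)\downarrow 0$ as $\alpha\downarrow 0$ for any fixed $T$, and $\mathbb{E}_0[\Psi(\theta_N)]\le \Psi(\varphi(N\alpha;\theta_0))+\Delta_2(\alpha,N\alpha)\Psi(\theta_0)$ for any step-size $\alpha$, $N\in\mathbb{N}_+$, $\theta_0\in\Theta$. Let $\bar\alpha>0$ and, for each $\alpha\in(0,\bar\alpha]$, $\gamma_\alpha\in(0,1)$ and $C_\alpha>0$ be constants (which exist under (A1) and (A2)) such that $\mathbb{E}[\Psi(\theta_n)]\le\gamma_\alpha^{\,n}C_\alpha\Psi(\theta_0)$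 for all $\theta_0\in\Theta$ and all $n\in\mathbb{N}_+$. For $\epsilon>0$ let $$\tau=\inf\{n\in\mathbb{N}:\Psi(\theta_n)\le\epsilon\}.$$ Then, for any $\alpha\in(0,\bar\alpha]$, there exist constants $\beta_0,\beta_1,\bar\beta_0,\bar\beta_1\in\mathbb{R}_+$ such that for any $\theta_0\in\Theta$, any $\epsilon\in(0,\Psi(\theta_0)]$ and any $\delta\in(0,1]$, $$\mathbb{E}[\tau]<\frac{\beta_1}{\ln(1/\gamma_\alpha)}\left(\ln\left(\frac{\Psi(\theta_0)}{\epsilon}\right)+\beta_0\right),$$ $$\Pr\left[\tau>\frac{\bar\beta_1}{\ln(1/\gamma_\alpha)}\left(\ln\left(\frac{\Psi(\theta_0)}{\epsilon\,\delta}\right)+\bar\beta_0\right)\right]\le\delta .$$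
   Context: Notation: $\mathbb{N}$ and $\mathbb{N}_+$ are the nonnegative and the positive integers; $\mathbb{R}_{\ge0}=[0,\infty)$, $\mathbb{R}_+=(0,\infty)$. Setting: $\Theta\subseteq\mathbb{R}^{D}$ for a positive integer $D$. The stochastic algorithm with constant step-size $\alpha>0$ is $\theta_{n+1}=\theta_n+\alpha F_n$, where the $F_n$ are random vectors in $\mathbb{R}^{D}$. Let $\{\mathcal{F}_n\}$ be the natural filtration associated with $\{\theta_n\}$. The dependency of $F_n$ on the past is only through $\theta_n$, and the conditional distribution of $F_n$ given $\theta_n=\theta$ does not depend on $n$ (time-homogeneity). The mean field $F(\theta)=\mathbb{E}[F_n\mid\theta_n=\theta]$ is assumed to be well defined. The associated mean ODE is $\mathrm{d}\theta/\mathrm{d}t=F(\theta)$. $\mathbb{E}_n=\mathbb{E}[\cdot\mid\mathcal{F}_n]$; in particular $\mathbb{E}_0$ is the conditional expectation given $\theta_0$. Standing assumption: for all sufficiently small $\alpha$, $\{\theta_n\}$ never leaves $\Theta$; step-sizes are understood to be in this range. *)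

theory Defs
  imports "HOL-Probability.Probability"
begin

definition natural_filtration ::
    "'w measure \<Rightarrow> (nat \<Rightarrow> 'w \<Rightarrow> 'a::topological_space) \<Rightarrow> nat \<Rightarrow> 'w measure" where
  "natural_filtration M X n =
     sigma (space M) {X k -` B \<inter> space M | k B. k \<le> n \<and> B \<in> sets borel}"

text \<open>The kernel \<open>\<kappa>\<close> is the conditional distribution of the update direction given the current
  state; it is the same for every \<open>n\<close> (time-homogeneity), and conditioning on the whole past
  \<open>\<theta> 0, \<dots>, \<theta> n\<close> gives a function of \<open>\<theta> n\<close> only. Values of \<open>\<kappa>\<close> outside \<open>\<Theta>\<close> are irrelevant.\<close>

definition stochastic_algorithm ::
    "'a::euclidean_space set \<Rightarrow> ('a \<Rightarrow> 'a measure) \<Rightarrow> real \<Rightarrow> 'a \<Rightarrow>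
     'w measure \<Rightarrow> (nat \<Rightarrow> 'w \<Rightarrow> 'a) \<Rightarrow> (nat \<Rightarrow> 'w \<Rightarrow> 'a) \<Rightarrow> bool" where
  "stochastic_algorithm \<Theta> \<kappa> \<alpha> \<theta>0 M \<theta> X \<longleftrightarrow>
     prob_space M \<and>
     (\<forall>n. X n \<in> borel_measurable M) \<and>
     (\<forall>\<omega>\<in>space M. \<theta> 0 \<omega> = \<theta>0) \<and>
     (\<forall>n. \<forall>\<omega>\<in>space M. \<theta> (Suc n) \<omega> = \<theta> n \<omega> + \<alpha> *\<^sub>R X n \<omega>) \<and>
     (\<forall>n. \<forall>\<omega>\<in>space M. \<theta> n \<omega> \<in> \<Theta>) \<and>
     (\<forall>n. \<forall>B\<in>sets borel. AE \<omega> in M.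
        real_cond_exp M (natural_filtration M \<theta> n) (indicat_real (X n -` B)) \<omega>
          = measure (\<kappa> (\<theta> n \<omega>)) B)"

definition mean_field ::
    "'a::euclidean_space set \<Rightarrow> ('a \<Rightarrow> 'a measure) \<Rightarrow> ('a \<Rightarrow> 'a) \<Rightarrow> bool" where
  "mean_field \<Theta> \<kappa> F \<longleftrightarrow> (\<forall>\<theta>\<in>\<Theta>. has_bochner_integral (\<kappa> \<theta>) (\<lambda>x. x) (F \<theta>))"

definition abs_continuous_on_interval ::
    "real \<Rightarrow> real \<Rightarrow> (real \<Rightarrow> 'a::real_normed_vector) \<Rightarrow> bool" where
  "abs_continuous_on_interval a b f \<longleftrightarrow>
     (\<forall>e>0. \<exists>d>0. \<forall>(n::nat) (l::nat \<Rightarrow> real) (r::nat \<Rightarrow> real).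
        (\<forall>i<n. a \<le> l i \<and> l i \<le> r i \<and> r i \<le> b) \<and>
        disjoint_family_on (\<lambda>i. {l i<..<r i}) {..<n} \<and>
        (\<Sum>i<n. r i - l i) < d
        \<longrightarrow> (\<Sum>i<n. norm (f (r i) - f (l i))) < e)"

text \<open>On the unbounded time axis, absolute continuity means absolute continuity on every compact
  interval.\<close>

definition ode_flow ::
    "'a::euclidean_space set \<Rightarrow> ('a \<Rightarrow> 'a) \<Rightarrow> (real \<Rightarrow> 'a \<Rightarrow> 'a) \<Rightarrow> bool" where
  "ode_flow \<Theta> F \<phi> \<longleftrightarrow>
     (\<forall>\<theta>\<in>\<Theta>. \<forall>t\<ge>0.
        \<phi> t \<theta> \<in> \<Theta> \<and>
        abs_continuous_on_interval 0 t (\<lambda>s. \<phi> s \<theta>) \<and>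
        set_integrable lebesgue {0..t} (\<lambda>s. F (\<phi> s \<theta>)) \<and>
        \<phi> t \<theta> = \<theta> + (LINT s:{0..t}|lebesgue. F (\<phi> s \<theta>)))"

text \<open>The infimum of the empty set is \<open>\<infinity>\<close> in \<^typ>\<open>enat\<close>, so the hitting time is infinite on paths
  that never reach the sublevel set.\<close>

definition hitting_time ::
    "('a \<Rightarrow> real) \<Rightarrow> real \<Rightarrow> (nat \<Rightarrow> 'w \<Rightarrow> 'a) \<Rightarrow> 'w \<Rightarrow> enat" where
  "hitting_time \<Psi> \<epsilon> \<theta> \<omega> = Inf {enat n | n. \<Psi> (\<theta> n \<omega>) \<le> \<epsilon>}"

end

theory Submission
  imports Defs
begin

text \<open>
  If the hitting time exceeds \<open>n\<close>, then in particular \<open>\<Psi> (\<theta> n) > \<epsilon>\<close>, so Markov's inequality and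
  the geometric decay of the mean of \<open>\<Psi> (\<theta> n)\<close> give \<open>Pr (\<tau> > n) \<le> min 1 (K * \<gamma> ^ n)\<close>, where
  \<open>K = max 1 C * \<Psi> \<theta>0 / \<epsilon>\<close>. This bound becomes nontrivial when \<open>n\<close> passes the threshold
  \<open>ln K / ln (1 / \<gamma>)\<close>, which is the origin of the logarithms in both claims.

  For the mean, \<open>\<tau>\<close> is at most the number of times \<open>n\<close> that the process spends above level \<open>\<epsilon>\<close>.
  The times below the threshold contribute at most one each, and those beyond it form a geometric
  series whose sum is at most \<open>1 / (1 - \<gamma>)\<close> (\<open>suminf_min_geometric_less\<close>). For the tail, one
  evaluates the bound at a time that exceeds the threshold of \<open>K / \<delta>\<close>. In either case everything
  except \<open>ln (\<Psi> \<theta>0 / \<epsilon>)\<close> and \<open>ln (1 / \<delta>)\<close> depends on \<open>\<alpha>\<close> alone and goes into the additive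
  constants \<open>\<beta>0\<close> and \<open>\<beta>bar0\<close>; the factors \<open>\<beta>1\<close> and \<open>\<beta>bar1\<close> can be taken to be one.
\<close>

lemma power_mult_le_of_ln_le:
  fixes \<gamma> K d :: real
  assumes "0 < \<gamma>" "\<gamma> < 1" "0 < K" "0 < d"
    and n: "ln (K / d) / ln (1 / \<gamma>) \<le> real n"
  shows "K * \<gamma> ^ n \<le> d"
proof -
  have L: "0 < ln (1 / \<gamma>)" using assms by simp
  have "ln (K / d) \<le> real n * ln (1 / \<gamma>)"
    using n L by (simp add: pos_divide_le_eq)
  then have "ln K + real n * ln \<gamma> \<le> ln d"
    using assms by (simp add: ln_div)
  then have "ln (K * \<gamma> ^ n) \<le> ln d"
    using assms by (simp add: ln_mult ln_realpow)
  then show ?thesis using assms by simp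
qed

text \<open>The sum is split at the first index where \<open>K * \<gamma> ^ n \<le> 1\<close>: the terms before it number fewer
  than \<open>ln K / ln (1 / \<gamma>) + 1\<close>, and the terms from it on are dominated by the powers of \<open>\<gamma>\<close>.\<close>

lemma suminf_min_geometric_less:
  fixes \<gamma> K :: real
  assumes g: "0 < \<gamma>" "\<gamma> < 1" and K: "1 \<le> K"
  shows "summable (\<lambda>n. min 1 (K * \<gamma> ^ n))"
    and "(\<Sum>n. min 1 (K * \<gamma> ^ n)) < ln K / ln (1 / \<gamma>) + 1 + 1 / (1 - \<gamma>)"
proof -
  have geo: "summable (\<lambda>n. \<gamma> ^ n)" "(\<Sum>n. \<gamma> ^ n) = 1 / (1 - \<gamma>)"
    using g by (auto simp: summable_geometric suminf_geometric)
  show sm: "summable (\<lambda>n. min 1 (K * \<gamma> ^ n))"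
    by (rule summable_comparison_test'[OF summable_mult[OF geo(1), of K], of 0]) (use g K in auto)
  define m where "m = nat \<lceil>ln K / ln (1 / \<gamma>)\<rceil>"
  have x0: "0 \<le> ln K / ln (1 / \<gamma>)" using g K by simp
  have m: "ln K / ln (1 / \<gamma>) \<le> real m" "real m < ln K / ln (1 / \<gamma>) + 1"
    unfolding m_def using x0 by linarith+
  have Km: "K * \<gamma> ^ m \<le> 1"
    by (rule power_mult_le_of_ln_le) (use g K m in auto)
  have tail: "min 1 (K * \<gamma> ^ (n + m)) \<le> \<gamma> ^ n" for n
  proof -
    have "K * \<gamma> ^ (n + m) = (K * \<gamma> ^ m) * \<gamma> ^ n" by (simp add: power_add)
    also have "\<dots> \<le> 1 * \<gamma> ^ n" by (rule mult_right_mono[OF Km]) (use g in simp)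
    finally show ?thesis by simp
  qed
  have "(\<Sum>n. min 1 (K * \<gamma> ^ n))
      = (\<Sum>n. min 1 (K * \<gamma> ^ (n + m))) + (\<Sum>n<m. min 1 (K * \<gamma> ^ n))"
    by (rule suminf_split_initial_segment[OF sm])
  also have "\<dots> \<le> (\<Sum>n. \<gamma> ^ n) + (\<Sum>n<m. 1)"
    by (intro add_mono suminf_le tail sum_mono geo summable_ignore_initial_segment[OF sm]) auto
  also have "\<dots> < ln K / ln (1 / \<gamma>) + 1 + 1 / (1 - \<gamma>)"
    using m geo by simp
  finally show "(\<Sum>n. min 1 (K * \<gamma> ^ n)) < ln K / ln (1 / \<gamma>) + 1 + 1 / (1 - \<gamma>)" .
qed

lemma above_level_before_hitting_time:
  assumes "enat n < hitting_time \<Psi> \<epsilon> \<theta> \<omega>"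
  shows "\<epsilon> < \<Psi> (\<theta> n \<omega>)"
proof (rule ccontr)
  assume "\<not> \<epsilon> < \<Psi> (\<theta> n \<omega>)"
  then have "hitting_time \<Psi> \<epsilon> \<theta> \<omega> \<le> enat n"
    unfolding hitting_time_def by (intro Inf_lower) auto
  with assms show False by simp
qed

lemma ennreal_of_enat_eq_suminf:
  "ennreal_of_enat t = (\<Sum>n. if enat n < t then 1 else 0)"
proof (cases t)
  case (enat k)
  have "(\<Sum>n. if enat n < t then 1 else 0) = (\<Sum>n<k. if enat n < t then 1 else (0::ennreal))"
    by (rule suminf_finite) (auto simp: enat)
  then show ?thesis by (simp add: enat)
next
  case infinity
  have "of_nat k \<le> (\<Sum>n. (1::ennreal))" for k
    using sum_le_suminf[of "\<lambda>_. 1::ennreal" "{..<k}"] by simp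
  then have "(\<Sum>n. (1::ennreal)) = \<top>"
    by (metis ennreal_SUP_of_nat_eq_top SUP_least top.extremum_unique)
  then show ?thesis by (simp add: infinity)
qed

text \<open>Comparing with the occupation time above the level, and not with the events \<open>\<tau> > n\<close>
  themselves, keeps the measurability of the hitting time out of the argument.\<close>

lemma hitting_time_le_occupation_time:
  "ennreal_of_enat (hitting_time \<Psi> \<epsilon> \<theta> \<omega>) \<le> (\<Sum>n. indicator {\<omega>. \<epsilon> < \<Psi> (\<theta> n \<omega>)} \<omega>)"
  unfolding ennreal_of_enat_eq_suminf
  by (intro suminf_le) (auto dest: above_level_before_hitting_time)

lemma (in prob_space) prob_above_level_le:
  fixes Y :: "'a \<Rightarrow> real"
  assumes [measurable]: "Y \<in> borel_measurable M" and eps: "0 < \<epsilon>" and B: "0 \<le> B"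
    and mean: "(\<integral>\<^sup>+ \<omega>. ennreal (Y \<omega>) \<partial>M) \<le> ennreal (B * \<epsilon>)"
  shows "prob {\<omega> \<in> space M. \<epsilon> < Y \<omega>} \<le> B"
proof -
  have "ennreal \<epsilon> * emeasure M {\<omega> \<in> space M. \<epsilon> < Y \<omega>}
      = (\<integral>\<^sup>+ \<omega>. ennreal \<epsilon> * indicator {\<omega> \<in> space M. \<epsilon> < Y \<omega>} \<omega> \<partial>M)"
    by (simp add: nn_integral_cmult_indicator)
  also have "\<dots> \<le> (\<integral>\<^sup>+ \<omega>. ennreal (Y \<omega>) \<partial>M)"
    by (intro nn_integral_mono) (auto simp: indicator_def intro: ennreal_leI)
  also note mean
  finally have "ennreal (\<epsilon> * prob {\<omega> \<in> space M. \<epsilon> < Y \<omega>}) \<le> ennreal (B * \<epsilon>)"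
    using eps by (simp add: emeasure_eq_measure ennreal_mult)
  then show ?thesis using eps B by (simp add: ennreal_le_iff mult.commute)
qed

text \<open>Integrating the occupation time turns the mean into the series of the exceedance
  probabilities, while the tail needs only one of them. The condition \<open>K \<ge> 1\<close> makes the
  thresholds \<open>ln K / ln (1 / \<gamma>)\<close> and \<open>ln (K / \<delta>) / ln (1 / \<gamma>)\<close> nonnegative, so that rounding them
  to natural numbers costs at most one. Both bounds are logarithmic in \<open>K\<close>, so a factor of \<open>K\<close>
  that is independent of the initial state becomes an additive constant.\<close>

lemma (in prob_space) hitting_time_bounds:
  fixes \<Psi> :: "'b \<Rightarrow> real" and \<theta> :: "nat \<Rightarrow> 'a \<Rightarrow> 'b"
  assumes Y [measurable]: "\<And>n. (\<lambda>\<omega>. \<Psi> (\<theta> n \<omega>)) \<in> borel_measurable M"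
    and g: "0 < \<gamma>" "\<gamma> < 1" and K: "1 \<le> K"
    and bound: "\<And>n. prob {\<omega> \<in> space M. \<epsilon> < \<Psi> (\<theta> n \<omega>)} \<le> K * \<gamma> ^ n"
  shows nn_integral_hitting_time_less:
      "(\<integral>\<^sup>+ \<omega>. ennreal_of_enat (hitting_time \<Psi> \<epsilon> \<theta> \<omega>) \<partial>M)
         < ennreal (ln K / ln (1 / \<gamma>) + 1 + 1 / (1 - \<gamma>))"
    and prob_hitting_time_greater_le:
      "\<And>\<delta>. 0 < \<delta> \<Longrightarrow> \<delta> \<le> 1 \<Longrightarrow>
         prob {\<omega> \<in> space M.
           ereal (ln (K / \<delta>) / ln (1 / \<gamma>) + 1) < ereal_of_enat (hitting_time \<Psi> \<epsilon> \<theta> \<omega>)} \<le> \<delta>"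
proof -
  have "(\<integral>\<^sup>+ \<omega>. ennreal_of_enat (hitting_time \<Psi> \<epsilon> \<theta> \<omega>) \<partial>M)
      \<le> (\<integral>\<^sup>+ \<omega>. (\<Sum>n. indicator {\<omega> \<in> space M. \<epsilon> < \<Psi> (\<theta> n \<omega>)} \<omega>) \<partial>M)"
    by (intro nn_integral_mono order_trans[OF hitting_time_le_occupation_time] suminf_le)
      (auto simp: indicator_def)
  also have "\<dots> = (\<Sum>n. emeasure M {\<omega> \<in> space M. \<epsilon> < \<Psi> (\<theta> n \<omega>)})"
    by (subst nn_integral_suminf) auto
  also have "\<dots> \<le> (\<Sum>n. ennreal (min 1 (K * \<gamma> ^ n)))"
    by (intro suminf_le) (auto simp: emeasure_eq_measure bound intro!: ennreal_leI)
  also have "\<dots> = ennreal (\<Sum>n. min 1 (K * \<gamma> ^ n))"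
    by (intro suminf_ennreal2 suminf_min_geometric_less(1)) (use g K in auto)
  also have "\<dots> < ennreal (ln K / ln (1 / \<gamma>) + 1 + 1 / (1 - \<gamma>))"
    using suminf_min_geometric_less[OF g K] g K
    by (intro ennreal_lessI) (auto intro!: add_nonneg_pos)
  finally show "(\<integral>\<^sup>+ \<omega>. ennreal_of_enat (hitting_time \<Psi> \<epsilon> \<theta> \<omega>) \<partial>M)
      < ennreal (ln K / ln (1 / \<gamma>) + 1 + 1 / (1 - \<gamma>))" .
next
  fix \<delta> :: real assume d: "0 < \<delta>" "\<delta> \<le> 1"
  define x where "x = ln (K / \<delta>) / ln (1 / \<gamma>)"
  have x0: "0 \<le> x" unfolding x_def using g K d by simp
  (* Rounding x + 1 down leaves an integer that is still at least x. *)
  define n where "n = nat \<lfloor>x + 1\<rfloor>"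
  have n: "x \<le> real n" "real n \<le> x + 1"
    unfolding n_def using x0 by linarith+
  have "enat n < hitting_time \<Psi> \<epsilon> \<theta> \<omega>"
    if "ereal (x + 1) < ereal_of_enat (hitting_time \<Psi> \<epsilon> \<theta> \<omega>)" for \<omega>
    using that n by (cases "hitting_time \<Psi> \<epsilon> \<theta> \<omega>") auto
  then have "prob {\<omega> \<in> space M. ereal (x + 1) < ereal_of_enat (hitting_time \<Psi> \<epsilon> \<theta> \<omega>)}
      \<le> prob {\<omega> \<in> space M. \<epsilon> < \<Psi> (\<theta> n \<omega>)}"
    by (intro finite_measure_mono) (auto dest: above_level_before_hitting_time)
  also have "\<dots> \<le> K * \<gamma> ^ n" by (rule bound)
  also have "\<dots> \<le> \<delta>"
    by (rule power_mult_le_of_ln_le) (use g K d n x_def in auto)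
  finally show "prob {\<omega> \<in> space M.
      ereal (ln (K / \<delta>) / ln (1 / \<gamma>) + 1) < ereal_of_enat (hitting_time \<Psi> \<epsilon> \<theta> \<omega>)} \<le> \<delta>"
    unfolding x_def .
qed

theorem corollary7:
  fixes \<Theta> :: "(real^'d) set"
    and \<alpha>max \<alpha>bar :: real
    and \<kappa> :: "real \<Rightarrow> real^'d \<Rightarrow> (real^'d) measure"
    and M :: "real \<Rightarrow> real^'d \<Rightarrow> 'w measure"
    and \<theta> X :: "real \<Rightarrow> real^'d \<Rightarrow> nat \<Rightarrow> 'w \<Rightarrow> real^'d"
    and F :: "real^'d \<Rightarrow> real^'d"
    and \<phi> :: "real \<Rightarrow> real^'d \<Rightarrow> real^'d"
    and \<Psi> :: "real^'d \<Rightarrow> real"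
    and \<gamma> C :: "real \<Rightarrow> real"
  assumes kernel:
      "\<And>\<alpha>. \<alpha> \<in> {0<..\<alpha>max} \<Longrightarrow> \<kappa> \<alpha> \<in> restrict_space borel \<Theta> \<rightarrow>\<^sub>M prob_algebra borel"
    and mean: "\<And>\<alpha>. \<alpha> \<in> {0<..\<alpha>max} \<Longrightarrow> mean_field \<Theta> (\<kappa> \<alpha>) F"
    and algorithm:
      "\<And>\<alpha> \<theta>0. \<alpha> \<in> {0<..\<alpha>max} \<Longrightarrow> \<theta>0 \<in> \<Theta> \<Longrightarrow>
         stochastic_algorithm \<Theta> (\<kappa> \<alpha>) \<alpha> \<theta>0 (M \<alpha> \<theta>0) (\<theta> \<alpha> \<theta>0) (X \<alpha> \<theta>0)"
    and flow: "ode_flow \<Theta> F \<phi>"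
    and Psi_measurable: "\<Psi> \<in> borel_measurable (restrict_space borel \<Theta>)"
    and Psi_nonneg: "\<And>\<theta>0. \<theta>0 \<in> \<Theta> \<Longrightarrow> 0 \<le> \<Psi> \<theta>0"
    and A1: "\<exists>\<Delta>1 :: real \<Rightarrow> real.
         (\<forall>t\<ge>0. 0 \<le> \<Delta>1 t) \<and>
         antimono_on {0..} \<Delta>1 \<and>
         (\<Delta>1 \<longlongrightarrow> 0) at_top \<and>
         (\<forall>\<theta>0\<in>\<Theta>. \<forall>t\<ge>0. \<Psi> (\<phi> t \<theta>0) \<le> \<Delta>1 t * \<Psi> \<theta>0)"
    and A2: "\<exists>\<Delta>2 :: real \<Rightarrow> real \<Rightarrow> real.
         (\<forall>\<alpha>>0. \<forall>T>0. 0 < \<Delta>2 \<alpha> T) \<and>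
         (\<forall>T>0. mono_on {0<..} (\<lambda>\<alpha>. \<Delta>2 \<alpha> T)) \<and>
         (\<forall>\<alpha>>0. mono_on {0<..} (\<Delta>2 \<alpha>)) \<and>
         (\<forall>T>0. ((\<lambda>\<alpha>. \<Delta>2 \<alpha> T) \<longlongrightarrow> 0) (at_right 0)) \<and>
         (\<forall>\<alpha>\<in>{0<..\<alpha>max}. \<forall>N\<ge>1. \<forall>\<theta>0\<in>\<Theta>. AE \<omega> in M \<alpha> \<theta>0.
            nn_cond_exp (M \<alpha> \<theta>0) (natural_filtration (M \<alpha> \<theta>0) (\<theta> \<alpha> \<theta>0) 0)
                (\<lambda>\<omega>. ennreal (\<Psi> (\<theta> \<alpha> \<theta>0 N \<omega>))) \<omega>
              \<le> ennreal (\<Psi> (\<phi> (real N * \<alpha>) \<theta>0) + \<Delta>2 \<alpha> (real N * \<alpha>) * \<Psi> \<theta>0))"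
    and alpha_bar: "0 < \<alpha>bar" "\<alpha>bar \<le> \<alpha>max"
    and gamma: "\<And>\<alpha>. \<alpha> \<in> {0<..\<alpha>bar} \<Longrightarrow> 0 < \<gamma> \<alpha> \<and> \<gamma> \<alpha> < 1"
    and C_pos: "\<And>\<alpha>. \<alpha> \<in> {0<..\<alpha>bar} \<Longrightarrow> 0 < C \<alpha>"
    and geometric: "\<And>\<alpha> \<theta>0 n. \<alpha> \<in> {0<..\<alpha>bar} \<Longrightarrow> \<theta>0 \<in> \<Theta> \<Longrightarrow> n \<ge> 1 \<Longrightarrow>
         (\<integral>\<^sup>+ \<omega>. ennreal (\<Psi> (\<theta> \<alpha> \<theta>0 n \<omega>)) \<partial>M \<alpha> \<theta>0) \<le> ennreal (\<gamma> \<alpha> ^ n * C \<alpha> * \<Psi> \<theta>0)"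
  shows "\<forall>\<alpha>\<in>{0<..\<alpha>bar}. \<exists>\<beta>0 \<beta>1 \<beta>bar0 \<beta>bar1 :: real.
           0 < \<beta>0 \<and> 0 < \<beta>1 \<and> 0 < \<beta>bar0 \<and> 0 < \<beta>bar1 \<and>
           (\<forall>\<theta>0\<in>\<Theta>. \<forall>\<epsilon>\<in>{0<..\<Psi> \<theta>0}. \<forall>\<delta>\<in>{0<..1}.
              (\<integral>\<^sup>+ \<omega>. ennreal_of_enat (hitting_time \<Psi> \<epsilon> (\<theta> \<alpha> \<theta>0) \<omega>) \<partial>M \<alpha> \<theta>0)
                < ennreal (\<beta>1 / ln (1 / \<gamma> \<alpha>) * (ln (\<Psi> \<theta>0 / \<epsilon>) + \<beta>0)) \<and>
              measure (M \<alpha> \<theta>0)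
                {\<omega> \<in> space (M \<alpha> \<theta>0).
                   ereal_of_enat (hitting_time \<Psi> \<epsilon> (\<theta> \<alpha> \<theta>0) \<omega>)
                     > ereal (\<beta>bar1 / ln (1 / \<gamma> \<alpha>) * (ln (\<Psi> \<theta>0 / (\<epsilon> * \<delta>)) + \<beta>bar0))}
                \<le> \<delta>)"
proof
  fix \<alpha> assume a: "\<alpha> \<in> {0<..\<alpha>bar}"
  then have a': "\<alpha> \<in> {0<..\<alpha>max}" using alpha_bar by auto
  have g: "0 < \<gamma> \<alpha>" "\<gamma> \<alpha> < 1" using gamma[OF a] by auto
  define L where "L = ln (1 / \<gamma> \<alpha>)"
  have L: "0 < L" unfolding L_def using g by simp
  (* With D >= 1 the probability bound also holds at time 0, which the decay hypothesis omits. *)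
  define D where "D = max 1 (C \<alpha>)"
  have D: "1 \<le> D" "C \<alpha> \<le> D" unfolding D_def by auto
  define b where "b = ln D + L * (1 + 1 / (1 - \<gamma> \<alpha>))"
  define bb where "bb = ln D + L"
  have "0 \<le> ln D" using D by simp
  moreover have "0 < L * (1 + 1 / (1 - \<gamma> \<alpha>))"
    using L g by (intro mult_pos_pos add_pos_pos) auto
  ultimately have pos: "0 < b" "0 < bb"
    unfolding b_def bb_def using L by linarith+
  have main:
    "(\<integral>\<^sup>+ \<omega>. ennreal_of_enat (hitting_time \<Psi> \<epsilon> (\<theta> \<alpha> \<theta>0) \<omega>) \<partial>M \<alpha> \<theta>0)
        < ennreal (1 / ln (1 / \<gamma> \<alpha>) * (ln (\<Psi> \<theta>0 / \<epsilon>) + b)) \<and>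
     measure (M \<alpha> \<theta>0)
        {\<omega> \<in> space (M \<alpha> \<theta>0).
           ereal_of_enat (hitting_time \<Psi> \<epsilon> (\<theta> \<alpha> \<theta>0) \<omega>)
             > ereal (1 / ln (1 / \<gamma> \<alpha>) * (ln (\<Psi> \<theta>0 / (\<epsilon> * \<delta>)) + bb))}
        \<le> \<delta>"
    if t: "\<theta>0 \<in> \<Theta>" and e: "\<epsilon> \<in> {0<..\<Psi> \<theta>0}" and d: "\<delta> \<in> {0<..1}" for \<theta>0 \<epsilon> \<delta>
  proof -
    note alg = algorithm[OF a' t, unfolded stochastic_algorithm_def]
    interpret prob_space "M \<alpha> \<theta>0" using alg by blast
    have start: "\<theta> \<alpha> \<theta>0 0 \<omega> = \<theta>0" if "\<omega> \<in> space (M \<alpha> \<theta>0)" for \<omega>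
      using alg that by blast
    have step: "\<theta> \<alpha> \<theta>0 (Suc n) \<omega> = \<theta> \<alpha> \<theta>0 n \<omega> + \<alpha> *\<^sub>R X \<alpha> \<theta>0 n \<omega>"
      if "\<omega> \<in> space (M \<alpha> \<theta>0)" for n \<omega>
      using alg that by blast
    have X [measurable]: "X \<alpha> \<theta>0 n \<in> borel_measurable (M \<alpha> \<theta>0)" for n
      using alg by blast
    have state: "\<theta> \<alpha> \<theta>0 n \<in> borel_measurable (M \<alpha> \<theta>0)" for n
    proof (induction n)
      case 0
      show ?case by (subst measurable_cong[where g = "\<lambda>_. \<theta>0"]) (auto simp: start)
    next
      case (Suc n)
      note [measurable] = Suc
      have "(\<lambda>\<omega>. \<theta> \<alpha> \<theta>0 n \<omega> + \<alpha> *\<^sub>R X \<alpha> \<theta>0 n \<omega>) \<in> borel_measurable (M \<alpha> \<theta>0)"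
        by measurable
      then show ?case by (rule measurable_cong[THEN iffD2, rotated]) (rule step)
    qed
    have "\<theta> \<alpha> \<theta>0 n \<in> M \<alpha> \<theta>0 \<rightarrow>\<^sub>M restrict_space borel \<Theta>" for n
      using alg by (intro measurable_restrict_space2 state) auto
    then have Y: "(\<lambda>\<omega>. \<Psi> (\<theta> \<alpha> \<theta>0 n \<omega>)) \<in> borel_measurable (M \<alpha> \<theta>0)" for n
      using Psi_measurable by (rule measurable_compose)
    define r where "r = \<Psi> \<theta>0 / \<epsilon>"
    have r: "1 \<le> r" "r * \<epsilon> = \<Psi> \<theta>0" unfolding r_def using e by auto
    have K: "1 \<le> D * r" using mult_mono[OF D(1) r(1)] D by simp
    have bound: "prob {\<omega> \<in> space (M \<alpha> \<theta>0). \<epsilon> < \<Psi> (\<theta> \<alpha> \<theta>0 n \<omega>)} \<le> D * r * \<gamma> \<alpha> ^ n" for n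
    proof (cases "n = 0")
      case True
      then show ?thesis using order_trans[OF prob_le_1 K] by simp
    next
      case False
      have "(\<integral>\<^sup>+ \<omega>. ennreal (\<Psi> (\<theta> \<alpha> \<theta>0 n \<omega>)) \<partial>M \<alpha> \<theta>0) \<le> ennreal (\<gamma> \<alpha> ^ n * C \<alpha> * \<Psi> \<theta>0)"
        using geometric[OF a t] False by simp
      also have "\<dots> \<le> ennreal (\<gamma> \<alpha> ^ n * D * \<Psi> \<theta>0)"
        using D g Psi_nonneg[OF t] by (intro ennreal_leI mult_right_mono mult_left_mono) auto
      also have "\<gamma> \<alpha> ^ n * D * \<Psi> \<theta>0 = D * r * \<gamma> \<alpha> ^ n * \<epsilon>"
        unfolding r(2)[symmetric] by (simp add: ac_simps)
      finally show ?thesis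
        using e g K by (intro prob_above_level_le Y) auto
    qed
    have eq1: "ln (D * r) / ln (1 / \<gamma> \<alpha>) + 1 + 1 / (1 - \<gamma> \<alpha>) = 1 / L * (ln r + b)"
      using D r L unfolding L_def[symmetric] b_def by (simp add: ln_mult field_simps)
    have "ln (D * r / \<delta>) = ln D + ln (r / \<delta>)"
      using D r d by (simp add: ln_mult ln_div)
    moreover have "r / \<delta> = \<Psi> \<theta>0 / (\<epsilon> * \<delta>)" unfolding r_def by simp
    ultimately have eq2:
      "ln (D * r / \<delta>) / ln (1 / \<gamma> \<alpha>) + 1 = 1 / L * (ln (\<Psi> \<theta>0 / (\<epsilon> * \<delta>)) + bb)"
      using L unfolding L_def[symmetric] bb_def by (simp add: field_simps)
    from nn_integral_hitting_time_less[where \<Psi> = \<Psi> and \<theta> = "\<theta> \<alpha> \<theta>0", OF Y g K bound]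
      prob_hitting_time_greater_le[where \<Psi> = \<Psi> and \<theta> = "\<theta> \<alpha> \<theta>0", OF Y g K bound, of \<delta>] d
    show ?thesis
      unfolding eq1 eq2 unfolding L_def r_def by simp
  qed
  show "\<exists>\<beta>0 \<beta>1 \<beta>bar0 \<beta>bar1 :: real.
           0 < \<beta>0 \<and> 0 < \<beta>1 \<and> 0 < \<beta>bar0 \<and> 0 < \<beta>bar1 \<and>
           (\<forall>\<theta>0\<in>\<Theta>. \<forall>\<epsilon>\<in>{0<..\<Psi> \<theta>0}. \<forall>\<delta>\<in>{0<..1}.
              (\<integral>\<^sup>+ \<omega>. ennreal_of_enat (hitting_time \<Psi> \<epsilon> (\<theta> \<alpha> \<theta>0) \<omega>) \<partial>M \<alpha> \<theta>0)
                < ennreal (\<beta>1 / ln (1 / \<gamma> \<alpha>) * (ln (\<Psi> \<theta>0 / \<epsilon>) + \<beta>0)) \<and>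
              measure (M \<alpha> \<theta>0)
                {\<omega> \<in> space (M \<alpha> \<theta>0).
                   ereal_of_enat (hitting_time \<Psi> \<epsilon> (\<theta> \<alpha> \<theta>0) \<omega>)
                     > ereal (\<beta>bar1 / ln (1 / \<gamma> \<alpha>) * (ln (\<Psi> \<theta>0 / (\<epsilon> * \<delta>)) + \<beta>bar0))}
                \<le> \<delta>)"
    by (rule exI[of _ b], rule exI[of _ 1], rule exI[of _ bb], rule exI[of _ 1])
      (intro conjI pos zero_less_one ballI; use main in blast)
qed

end
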